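(* Let $X_t=\sum_{i=1}^{N_t}Y_i$, $t\in\mathbb{R}_+$, be a compound Poisson process, where $N$ is a Poisson process with parameter $\lambda>0$ that is independent of the sequence $(Y_i)_{i\ge1}$ of i.i.d. real random variables. Let $\Omega_X=\{\omega\in\Omega:X(\omega)\in\mathcal S'(\mathbb{R})\}$. Then there is a set $A$ of probability one such that for all $\omega\in\Omega_X\cap A$, the function $t\mapsto X_t(\omega)$ is slowly growing.
   Context: $(\Omega,\mathcal F,\mathbb P)$ is a complete probability space. A function $f$ is slowly growing if $\sup_t|f(t)|(1+|t|)^{-\alpha}<\infty$ for some $\alpha\ge0$ (supremum over the domain of $f$, here $\mathbb{R}_+$). $X(\omega)$ is viewed as an element of $\mathcal D'(\mathbb{R})$ via $\langle X(\omega),\varphi\rangle=\int_{\mathbb{R}_+}X_t(\omega)\varphi(t)\,dt$. $\mathcal S'(\mathbb{R})$ is the space of tempered distributions (continuous linear functionals on the Schwartz space $\mathcal S(\mathbb{R})$). In the definition of $\Omega_X$ it is understood that when $X(\omega)\in\mathcal S'(\mathbb{R})$, the associated continuous linear functional is $\langle X(\omega),\varphi\rangle=\int_{\mathbb{R}_+}X_t(\omega)\varphi(t)\,dt$ for all $\varphi\in\mathcal S(\mathbb{R})$. *)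

theory Defs
  imports "HOL-Probability.Probability"
begin

(* Test functions are real-valued, since the paths of the process are real-valued. *)
definition schwartz_space :: "(real \<Rightarrow> real) set" where
  "schwartz_space =
     {\<phi>. (\<forall>n. (deriv ^^ n) \<phi> differentiable_on UNIV) \<and>
         (\<forall>k n. bounded (range (\<lambda>t. t ^ k * (deriv ^^ n) \<phi> t)))}"

definition schwartz_seminorm :: "nat \<Rightarrow> nat \<Rightarrow> (real \<Rightarrow> real) \<Rightarrow> real" where
  "schwartz_seminorm k n \<phi> = (SUP t. \<bar>t ^ k * (deriv ^^ n) \<phi> t\<bar>)"

(* The locally convex topology of the Schwartz space: the open seminorm balls form a subbase. *)
definition schwartz_topology :: "(real \<Rightarrow> real) topology" where
  "schwartz_topology = topology_generated_by
     {{\<psi> \<in> schwartz_space. schwartz_seminorm k n (\<lambda>t. \<psi> t - \<phi> t) < e} | \<phi> k n e.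
        \<phi> \<in> schwartz_space \<and> e > 0}"

lemma topspace_schwartz_topology: "topspace schwartz_topology = schwartz_space"
proof -
  show ?thesis
  proof (intro subset_antisym subsetI)
    fix \<phi> assume "\<phi> \<in> topspace schwartz_topology"
    then show "\<phi> \<in> schwartz_space"
      unfolding schwartz_topology_def topology_generated_by_topspace by blast
  next
    fix \<phi> assume mem: "\<phi> \<in> schwartz_space"
    let ?B = "{\<psi> \<in> schwartz_space. schwartz_seminorm 0 0 (\<lambda>t. \<psi> t - \<phi> t) < 1}"
    have "schwartz_seminorm 0 0 (\<lambda>t. \<phi> t - \<phi> t) = 0"
      by (simp add: schwartz_seminorm_def)
    with mem have "\<phi> \<in> ?B" by simp
    moreover from mem have "?B \<in> {{\<psi> \<in> schwartz_space.
        schwartz_seminorm k n (\<lambda>t. \<psi> t - \<eta> t) < e} | \<eta> k n e. \<eta> \<in> schwartz_space \<and> e > 0}"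
      by (intro CollectI exI[of _ \<phi>] exI[of _ "0::nat"] exI[of _ "0::nat"] exI[of _ "1::real"] conjI refl) auto
    ultimately show "\<phi> \<in> topspace schwartz_topology"
      unfolding schwartz_topology_def topology_generated_by_topspace by (rule UnionI[rotated])
  qed
qed

(* Only the values of T on the Schwartz space are relevant. *)
definition tempered_distribution :: "((real \<Rightarrow> real) \<Rightarrow> real) \<Rightarrow> bool" where
  "tempered_distribution T \<longleftrightarrow>
     (\<forall>\<phi>\<in>schwartz_space. \<forall>\<psi>\<in>schwartz_space. \<forall>a b.
        T (\<lambda>t. a * \<phi> t + b * \<psi> t) = a * T \<phi> + b * T \<psi>) \<and>
     continuous_map schwartz_topology euclideanreal T"

(* A function f on the half-line belongs to S'(R) if the functional
   phi |-> integral of f phi over the half-line is defined on all Schwartz functions and is a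
   tempered distribution.  Integrability is required separately because the integral of a
   non-integrable function is 0 by convention. *)
definition halfline_fun_tempered :: "(real \<Rightarrow> real) \<Rightarrow> bool" where
  "halfline_fun_tempered f \<longleftrightarrow>
     (\<forall>\<phi>\<in>schwartz_space. set_integrable lebesgue {0..} (\<lambda>t. f t * \<phi> t)) \<and>
     tempered_distribution (\<lambda>\<phi>. LINT t:{0..}|lebesgue. f t * \<phi> t)"

definition slowly_growing_on :: "real set \<Rightarrow> (real \<Rightarrow> real) \<Rightarrow> bool" where
  "slowly_growing_on D f \<longleftrightarrow>
     (\<exists>\<alpha>\<ge>0. bdd_above ((\<lambda>t. \<bar>f t\<bar> * (1 + \<bar>t\<bar>) powr (- \<alpha>)) ` D))"

definition cadlag_on_halfline :: "(real \<Rightarrow> 'b::topological_space) \<Rightarrow> bool" where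
  "cadlag_on_halfline f \<longleftrightarrow>
     (\<forall>t\<ge>0. continuous (at_right t) f) \<and> (\<forall>t>0. \<exists>l. (f \<longlongrightarrow> l) (at_left t))"

(* Only times t >= 0 matter.  Increments are taken in the integers because subtraction of natural
   numbers truncates.  As is usual for Levy processes, the start at 0 and the path regularity are
   required almost surely. *)
definition (in prob_space) poisson_process :: "real \<Rightarrow> (real \<Rightarrow> 'a \<Rightarrow> nat) \<Rightarrow> bool" where
  "poisson_process rate N \<longleftrightarrow>
     (\<forall>t\<ge>0. random_variable (count_space UNIV) (N t)) \<and>
     (AE \<omega> in M. N 0 \<omega> = 0) \<and>
     (\<forall>(n::nat) (t :: nat \<Rightarrow> real). 0 \<le> t 0 \<and> (\<forall>i<n. t i < t (Suc i)) \<longrightarrow>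
        indep_vars (\<lambda>_. count_space UNIV)
          (\<lambda>i \<omega>. int (N (t (Suc i)) \<omega>) - int (N (t i) \<omega>)) {..<n}) \<and>
     (\<forall>s t. 0 \<le> s \<and> s < t \<longrightarrow>
        distr M (count_space UNIV) (\<lambda>\<omega>. int (N t \<omega>) - int (N s \<omega>)) =
        measure_pmf (map_pmf int (poisson_pmf (rate * (t - s))))) \<and>
     (AE \<omega> in M. cadlag_on_halfline (\<lambda>t. N t \<omega>))"

(* The sequence is indexed by i >= 1. *)
definition (in prob_space) iid_sequence :: "(nat \<Rightarrow> 'a \<Rightarrow> real) \<Rightarrow> bool" where
  "iid_sequence Y \<longleftrightarrow>
     indep_vars (\<lambda>_. borel) Y {1..} \<and>
     (\<forall>i\<ge>1. distr M borel (Y i) = distr M borel (Y 1))"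

(* Independence of the sigma-algebras generated by the whole process N and the whole sequence Y. *)
definition (in prob_space) indep_process_sequence ::
    "(real \<Rightarrow> 'a \<Rightarrow> nat) \<Rightarrow> (nat \<Rightarrow> 'a \<Rightarrow> real) \<Rightarrow> bool" where
  "indep_process_sequence N Y \<longleftrightarrow>
     indep_set
       (sets (vimage_algebra (space M) (\<lambda>\<omega>. \<lambda>t\<in>{0..}. N t \<omega>) (\<Pi>\<^sub>M t\<in>{0..}. count_space UNIV)))
       (sets (vimage_algebra (space M) (\<lambda>\<omega>. \<lambda>i\<in>{1..}. Y i \<omega>) (\<Pi>\<^sub>M i\<in>{1..}. borel)))"

definition compound_process ::
    "(real \<Rightarrow> 'a \<Rightarrow> nat) \<Rightarrow> (nat \<Rightarrow> 'a \<Rightarrow> real) \<Rightarrow> real \<Rightarrow> 'a \<Rightarrow> real" where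
  "compound_process N Y t \<omega> = (\<Sum>i=1..N t \<omega>. Y i \<omega>)"

definition tempered_event :: "'a measure \<Rightarrow> (real \<Rightarrow> 'a \<Rightarrow> real) \<Rightarrow> 'a set" where
  "tempered_event M X = {\<omega> \<in> space M. halfline_fun_tempered (\<lambda>t. X t \<omega>)}"

end

theory Submission
  imports Defs
begin

text \<open>
  For a fixed outcome, \<open>X t\<close> depends on \<open>t\<close> only through \<open>N t\<close>, so the path of \<open>X\<close> is constant
  wherever the counting path \<open>N\<close> is.  The growth of the path follows from playing a lower bound for the length of the
  constancy intervals against an upper bound for local means of the path; both are polynomial in
  time.

  \<^emph>\<open>Local means.\<close>  If \<open>f\<close> is integrable against every Schwartz function, then a lower
  bound \<open>v\<close> for \<open>\<bar>f\<bar>\<close> on an interval of length \<open>l \<le> 1\<close> starting at \<open>s\<close> forces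
  \<open>v * l \<le> C * (1 + s) ^ k\<close>, with \<open>C\<close> and \<open>k\<close> depending only on \<open>f\<close>
  (\<open>integrable_against_schwartz_local_bound\<close>).  Otherwise the bounds with \<open>C = 4 ^ j\<close>,
  \<open>k = j\<close> fail at points \<open>s j\<close>, and the sum of Gaussians centred at the \<open>s j\<close> with weights
  \<open>1 / (2 ^ j * (1 + s j) ^ j)\<close> is a positive Schwartz function
  (\<open>gauss_series_in_schwartz_space\<close>) against which \<open>\<bar>f\<bar>\<close> has infinite integral.  This is where
  temperedness enters.

  \<^emph>\<open>Constancy intervals.\<close>  Divide \<open>[m + 1, m + 2]\<close> into \<open>(m + 1)\<^sup>2\<close> cells.  A Poisson process has
  two or more jumps in a window of three neighbouring cells with probability of order
  \<open>1 / (m + 1) ^ 4\<close>, hence in one of the \<open>(m + 1)\<^sup>2\<close> windows with probability of order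
  \<open>1 / (m + 1)\<^sup>2\<close>.  By Borel--Cantelli almost every path has, for all large \<open>m\<close>, at most one jump per
  window (\<open>poisson_process_AE_sparse_jumps\<close>).  A time in the middle cell of such a window has a
  whole cell width free of jumps on its left or on its right.

  Together, \<open>\<bar>X t\<bar> / (m + 1)\<^sup>2 \<le> C * (1 + t) ^ k\<close> for \<open>t\<close> in \<open>[m + 1, m + 2]\<close> with \<open>m\<close> large; on the
  remaining bounded time interval the path takes finitely many values
  (\<open>slowly_growing_if_sparse_jumps\<close>).
\<close>

section \<open>Schwartz functions as sums of Gaussians\<close>

text \<open>Up to sign these are the Hermite polynomials: the \<open>n\<close>-th derivative of \<open>exp (- x\<^sup>2)\<close> is
  the \<open>n\<close>-th polynomial times \<open>exp (- x\<^sup>2)\<close>.\<close>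
primrec gauss_poly :: "nat \<Rightarrow> real poly" where
  "gauss_poly 0 = 1"
| "gauss_poly (Suc n) = pderiv (gauss_poly n) - [:0, 2:] * gauss_poly n"

definition gauss_deriv :: "nat \<Rightarrow> real \<Rightarrow> real" where
  "gauss_deriv n x = poly (gauss_poly n) x * exp (- x\<^sup>2)"

lemma gauss_deriv_0: "gauss_deriv 0 x = exp (- x\<^sup>2)"
  by (simp add: gauss_deriv_def)

lemma has_field_derivative_gauss_deriv:
  "(gauss_deriv n has_field_derivative gauss_deriv (Suc n) x) (at x)"
  unfolding gauss_deriv_def
  by (rule derivative_eq_intros poly_DERIV refl | simp add: algebra_simps)+

text \<open>Each monomial is controlled by the exponential series,
  \<open>\<bar>x\<bar> ^ i / i! \<le> exp \<bar>x\<bar>\<close>, and \<open>\<bar>x\<bar> \<le> 1 + x\<^sup>2\<close>.\<close>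
lemma poly_times_gauss_bounded:
  fixes p :: "real poly"
  shows "\<exists>C\<ge>0. \<forall>x. \<bar>poly p x\<bar> * exp (- x\<^sup>2) \<le> C"
proof (intro exI conjI allI)
  let ?C = "\<Sum>i\<le>degree p. \<bar>coeff p i\<bar> * (fact i * exp 1)"
  show "0 \<le> ?C" by (intro sum_nonneg) simp
  fix x :: real
  have mono: "\<bar>x\<bar> ^ i * exp (- x\<^sup>2) \<le> fact i * exp 1" for i
  proof -
    have "\<bar>x\<bar> ^ i \<le> fact i * exp \<bar>x\<bar>"
    proof -
      have "(\<Sum>j\<in>{i}. \<bar>x\<bar> ^ j /\<^sub>R fact j) \<le> (\<Sum>j. \<bar>x\<bar> ^ j /\<^sub>R fact j)"
        by (intro sum_le_suminf summable_exp_generic) auto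
      then show ?thesis
        by (simp add: exp_def divide_simps mult.commute)
    qed
    also have "\<bar>x\<bar> \<le> 1 + x\<^sup>2"
      using zero_le_power2[of "\<bar>x\<bar> - 1/2"] by (simp add: power2_eq_square algebra_simps)
    then have "fact i * exp \<bar>x\<bar> \<le> fact i * exp (1 + x\<^sup>2)" by simp
    finally have "\<bar>x\<bar> ^ i * exp (- x\<^sup>2) \<le> fact i * exp (1 + x\<^sup>2) * exp (- x\<^sup>2)"
      by (intro mult_right_mono) auto
    also have "\<dots> = fact i * exp 1" by (simp add: mult.assoc flip: exp_add)
    finally show ?thesis .
  qed
  have "\<bar>poly p x\<bar> \<le> (\<Sum>i\<le>degree p. \<bar>coeff p i\<bar> * \<bar>x\<bar> ^ i)"
    unfolding poly_altdef by (rule order_trans[OF sum_abs]) (simp add: abs_mult power_abs)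
  then have "\<bar>poly p x\<bar> * exp (- x\<^sup>2) \<le> (\<Sum>i\<le>degree p. \<bar>coeff p i\<bar> * \<bar>x\<bar> ^ i) * exp (- x\<^sup>2)"
    by (intro mult_right_mono) auto
  also have "\<dots> = (\<Sum>i\<le>degree p. \<bar>coeff p i\<bar> * (\<bar>x\<bar> ^ i * exp (- x\<^sup>2)))"
    by (simp add: sum_distrib_right mult.assoc)
  also have "\<dots> \<le> ?C"
    by (intro sum_mono mult_left_mono mono) auto
  finally show "\<bar>poly p x\<bar> * exp (- x\<^sup>2) \<le> ?C" .
qed

text \<open>Moving a Gaussian to the point \<open>a\<close> costs each Schwartz seminorm only a power of \<open>1 + a\<close>,
  because \<open>\<bar>t\<bar> \<le> (1 + \<bar>t - a\<bar>) * (1 + a)\<close>.\<close>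
lemma shifted_gauss_deriv_bound:
  obtains C where "C \<ge> 0"
    "\<And>a t. a \<ge> 0 \<Longrightarrow> \<bar>t ^ k * gauss_deriv n (t - a)\<bar> \<le> C * (1 + a) ^ k"
proof -
  obtain C where C: "C \<ge> 0"
      "\<And>x. \<bar>poly ([:2, 0, 1:] ^ k * gauss_poly n) x\<bar> * exp (- x\<^sup>2) \<le> C"
    using poly_times_gauss_bounded by blast
  have "\<bar>t ^ k * gauss_deriv n (t - a)\<bar> \<le> C * (1 + a) ^ k" if "a \<ge> 0" for a t
  proof -
    define s where "s = t - a"
    have s: "\<bar>s\<bar> \<le> 1 + s\<^sup>2"
      using zero_le_power2[of "\<bar>s\<bar> - 1/2"] by (simp add: power2_eq_square algebra_simps)
    have "\<bar>t\<bar> \<le> \<bar>s\<bar> + a" using that by (simp add: s_def)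
    also have "\<dots> \<le> (1 + \<bar>s\<bar>) * (1 + a)" using that by (simp add: algebra_simps)
    also have "\<dots> \<le> (2 + s\<^sup>2) * (1 + a)" using that s by (intro mult_right_mono) auto
    finally have "\<bar>t\<bar> ^ k \<le> ((2 + s\<^sup>2) * (1 + a)) ^ k" by (intro power_mono) auto
    then have "\<bar>t ^ k * gauss_deriv n s\<bar> \<le> ((2 + s\<^sup>2) * (1 + a)) ^ k * \<bar>gauss_deriv n s\<bar>"
      by (simp add: abs_mult power_abs mult_right_mono)
    also have "\<dots> = (\<bar>poly ([:2, 0, 1:] ^ k * gauss_poly n) s\<bar> * exp (- s\<^sup>2)) * (1 + a) ^ k"
      by (simp add: gauss_deriv_def abs_mult power_abs power_mult_distrib power2_eq_square)
    also have "\<dots> \<le> C * (1 + a) ^ k"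
      using that by (intro mult_right_mono C) auto
    finally show ?thesis by (simp add: s_def)
  qed
  with C(1) show ?thesis by (rule that)
qed

text \<open>The weights beat every power of the centres, so by the preceding bound the series
  of derivatives of each order, multiplied by any power of \<open>t\<close>, has a summable majorant that is
  uniform in \<open>t\<close>; it can therefore be differentiated term by term.\<close>
lemma
  fixes c a :: "nat \<Rightarrow> real"
  assumes c: "\<And>j. c j \<ge> 0" and a: "\<And>j. a j \<ge> 0"
    and decay: "\<And>k. summable (\<lambda>j. c j * (1 + a j) ^ k)"
  defines "\<phi> \<equiv> \<lambda>t. \<Sum>j. c j * gauss_deriv 0 (t - a j)"
  shows summable_gauss_series: "summable (\<lambda>j. c j * gauss_deriv 0 (t - a j))"
    and gauss_series_in_schwartz_space: "\<phi> \<in> schwartz_space"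
proof -
  define F where "F n t = (\<Sum>j. c j * gauss_deriv n (t - a j))" for n t
  have major: "\<exists>B. summable B \<and> (\<forall>j t. \<bar>t ^ k * (c j * gauss_deriv n (t - a j))\<bar> \<le> B j)" for k n
  proof -
    obtain C where C: "C \<ge> 0"
        "\<And>b t. b \<ge> 0 \<Longrightarrow> \<bar>t ^ k * gauss_deriv n (t - b)\<bar> \<le> C * (1 + b) ^ k"
      using shifted_gauss_deriv_bound[of k n] by blast
    have "\<bar>t ^ k * (c j * gauss_deriv n (t - a j))\<bar> \<le> C * (c j * (1 + a j) ^ k)" for j t
      using mult_left_mono[OF C(2)[OF a, of t j] c, of j] c[of j] by (simp add: abs_mult mult_ac)
    then show ?thesis
      using summable_mult[OF decay, of C k] by blast
  qed
  have summ: "summable (\<lambda>j. c j * gauss_deriv n (t - a j))" for n t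
  proof -
    obtain B where B: "summable B" "\<And>j t. \<bar>t ^ 0 * (c j * gauss_deriv n (t - a j))\<bar> \<le> B j"
      using major by blast
    then show ?thesis by (intro summable_comparison_test'[OF B(1)]) auto
  qed
  then show "summable (\<lambda>j. c j * gauss_deriv 0 (t - a j))" .
  have deriv_F: "(F n has_field_derivative F (Suc n) t) (at t)" for n t
  proof -
    obtain B where B: "summable B" "\<And>j t. \<bar>t ^ 0 * (c j * gauss_deriv (Suc n) (t - a j))\<bar> \<le> B j"
      using major by blast
    have "uniformly_convergent_on UNIV (\<lambda>m t. \<Sum>j<m. c j * gauss_deriv (Suc n) (t - a j))"
      using B by (intro uniformly_convergentI[OF Weierstrass_m_test[where M = B]]) auto
    moreover have "((\<lambda>t. c j * gauss_deriv n (t - a j)) has_field_derivative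
        c j * gauss_deriv (Suc n) (t - a j)) (at t)" for j t
      by (rule derivative_eq_intros DERIV_chain2[OF has_field_derivative_gauss_deriv] refl | simp)+
    ultimately show ?thesis
      unfolding F_def
      by (intro has_field_derivative_series'(2)[where S = UNIV and x0 = t]) (auto intro: summ)
  qed
  have iter: "(deriv ^^ n) \<phi> = F n" for n
  proof (induction n)
    case 0
    then show ?case by (simp add: \<phi>_def F_def fun_eq_iff)
  next
    case (Suc n)
    have "deriv (F n) = F (Suc n)" using DERIV_imp_deriv[OF deriv_F] by (simp add: fun_eq_iff)
    with Suc show ?case by simp
  qed
  have "(deriv ^^ n) \<phi> differentiable_on UNIV" for n
    unfolding iter differentiable_on_def using deriv_F real_differentiable_def by blast
  moreover have "bounded (range (\<lambda>t. t ^ k * (deriv ^^ n) \<phi> t))" for k n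
  proof -
    obtain B where B: "summable B" "\<And>j t. \<bar>t ^ k * (c j * gauss_deriv n (t - a j))\<bar> \<le> B j"
      using major by blast
    have "\<bar>t ^ k * F n t\<bar> \<le> suminf B" for t
    proof -
      have "t ^ k * F n t = (\<Sum>j. t ^ k * (c j * gauss_deriv n (t - a j)))"
        unfolding F_def by (intro suminf_mult[symmetric] summ)
      moreover have "\<bar>\<dots>\<bar> \<le> suminf B"
        using norm_suminf_le[where f = "\<lambda>j. t ^ k * (c j * gauss_deriv n (t - a j))" and g = B] B
        by simp
      ultimately show ?thesis by simp
    qed
    then show ?thesis unfolding iter by (auto simp: bounded_iff)
  qed
  ultimately show "\<phi> \<in> schwartz_space" by (simp add: schwartz_space_def)
qed

text \<open>A condensation of singularities: if no pair \<open>(k, C)\<close> works, one Schwartz function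
  collects the counterexamples to all the pairs \<open>(j, 4 ^ j)\<close>.  The weights decay
  geometrically even if the centres \<open>s j\<close> stay bounded, so that case is covered as well.  The bound is phrased with a constant \<open>v\<close> below \<open>\<bar>f\<bar>\<close> rather than with an integral
  of \<open>\<bar>f\<bar>\<close> because it will be used on intervals where \<open>f\<close> is constant.\<close>
lemma integrable_against_schwartz_local_bound:
  fixes f :: "real \<Rightarrow> real"
  assumes int: "\<And>\<phi>. \<phi> \<in> schwartz_space \<Longrightarrow> set_integrable lebesgue {0..} (\<lambda>t. f t * \<phi> t)"
  obtains k C where "C \<ge> 0"
    "\<And>s r v. 0 \<le> s \<Longrightarrow> s \<le> r \<Longrightarrow> r \<le> s + 1 \<Longrightarrow> 0 \<le> v \<Longrightarrow> (\<And>t. t \<in> {s..r} \<Longrightarrow> v \<le> \<bar>f t\<bar>)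
      \<Longrightarrow> v * (r - s) \<le> C * (1 + s) ^ k"
proof (rule ccontr)
  note found = that
  assume "\<not> thesis"
  have "\<exists>s r v. 0 \<le> s \<and> s \<le> r \<and> r \<le> s + 1 \<and> 0 \<le> v \<and> (\<forall>t\<in>{s..r}. v \<le> \<bar>f t\<bar>)
      \<and> 4 ^ j * (1 + s) ^ j < v * (r - s)" for j :: nat
  proof (rule ccontr)
    assume "\<not> ?thesis"
    then have neg: "v * (r - s) \<le> 4 ^ j * (1 + s) ^ j"
      if "0 \<le> s" "s \<le> r" "r \<le> s + 1" "0 \<le> v" "\<And>t. t \<in> {s..r} \<Longrightarrow> v \<le> \<bar>f t\<bar>" for s r v
      using that by (meson not_less)
    have "(0::real) \<le> 4 ^ j" by simp
    from \<open>\<not> thesis\<close> found[OF this neg] show False by blast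
  qed
  then obtain s r v where
    srv: "\<And>j. 0 \<le> s j" "\<And>j. s j \<le> r j" "\<And>j. r j \<le> s j + 1" "\<And>j. 0 \<le> v j"
      "\<And>j t. t \<in> {s j..r j} \<Longrightarrow> v j \<le> \<bar>f t\<bar>"
    and large: "\<And>j::nat. 4 ^ j * (1 + s j) ^ j < v j * (r j - s j)"
    by metis
  \<comment> \<open>The factor \<open>4 ^ j\<close> in the failing bounds is split evenly: one \<open>2 ^ j\<close> makes the weights
    summable, the other one makes the integrals blow up.\<close>
  define c where "c j = 1 / (2 ^ j * (1 + s j) ^ j)" for j
  have c_pos: "c j > 0" for j using srv(1)[of j] by (simp add: c_def)
  define \<phi> where "\<phi> = (\<lambda>t. \<Sum>j. c j * gauss_deriv 0 (t - s j))"
  have decay: "summable (\<lambda>j. c j * (1 + s j) ^ k)" for k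
  proof (rule summable_comparison_test'[where g = "\<lambda>j. (1/2) ^ j" and N = k])
    fix j assume "k \<le> j"
    then have "(1 + s j) ^ k \<le> (1 + s j) ^ j" using srv(1)[of j] by (intro power_increasing) auto
    then show "norm (c j * (1 + s j) ^ k) \<le> (1/2) ^ j"
      using srv(1)[of j] by (simp add: c_def field_simps)
  qed auto
  have schwartz: "\<phi> \<in> schwartz_space"
    unfolding \<phi>_def using c_pos srv(1) decay
    by (intro gauss_series_in_schwartz_space) (auto intro: less_imp_le)
  have phi_ge: "c j * gauss_deriv 0 (t - s j) \<le> \<phi> t" for j t
  proof -
    have "(\<Sum>i\<in>{j}. c i * gauss_deriv 0 (t - s i)) \<le> \<phi> t"
      unfolding \<phi>_def using c_pos srv(1) decay
      by (intro sum_le_suminf summable_gauss_series)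
         (auto intro: less_imp_le mult_nonneg_nonneg simp: gauss_deriv_0)
    then show ?thesis by simp
  qed
  define K where "K = (LINT t:{0..}|lebesgue. \<bar>f t * \<phi> t\<bar>)"
  have intf: "set_integrable lebesgue {0..} (\<lambda>t. \<bar>f t * \<phi> t\<bar>)"
    using int[OF schwartz] by (rule set_integrable_abs)
  have "2 ^ j \<le> exp 1 * K" for j :: nat
  proof -
    have "c j * exp (- 1) * (v j * (r j - s j)) =
        (LINT t:{s j..r j}|lebesgue. c j * exp (- 1) * v j)"
      using srv(2)[of j] by (simp add: set_lebesgue_integral_def)
    also have "\<dots> \<le> K"
      unfolding K_def set_lebesgue_integral_def
    proof (rule integral_mono)
      show "integrable lebesgue (\<lambda>t. indicat_real {s j..r j} t *\<^sub>R (c j * exp (- 1) * v j))"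
        using srv(2)[of j] by (simp add: integrable_indicator_iff)
      show "integrable lebesgue (\<lambda>t. indicat_real {0..} t *\<^sub>R \<bar>f t * \<phi> t\<bar>)"
        using intf by (simp add: set_integrable_def)
      fix t
      show "indicat_real {s j..r j} t *\<^sub>R (c j * exp (- 1) * v j)
          \<le> indicat_real {0..} t *\<^sub>R \<bar>f t * \<phi> t\<bar>"
      proof (cases "t \<in> {s j..r j}")
        case True
        then have "\<bar>t - s j\<bar> \<le> 1" using srv(3)[of j] by auto
        then have "(t - s j)\<^sup>2 \<le> 1" by (simp add: abs_square_le_1)
        then have "c j * exp (- 1) \<le> c j * gauss_deriv 0 (t - s j)"
          using c_pos[of j] by (simp add: gauss_deriv_0)
        also note phi_ge[of j t]
        finally have "c j * exp (- 1) \<le> \<bar>\<phi> t\<bar>" by simp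
        then have "c j * exp (- 1) * v j \<le> \<bar>\<phi> t\<bar> * \<bar>f t\<bar>"
          using srv(4) srv(5)[OF True] by (intro mult_mono) auto
        moreover have "0 \<le> t" using True srv(1)[of j] by auto
        ultimately show ?thesis using True by (simp add: abs_mult mult.commute)
      next
        case False
        then have "indicat_real {s j..r j} t = 0" by simp
        moreover have "0 \<le> indicat_real {0..} t *\<^sub>R \<bar>f t * \<phi> t\<bar>" by simp
        ultimately show ?thesis by (simp only: scaleR_zero_left)
      qed
    qed
    finally have "c j * (v j * (r j - s j)) \<le> exp 1 * K"
      by (simp add: exp_minus field_simps)
    moreover have "c j * (4 ^ j * (1 + s j) ^ j) \<le> c j * (v j * (r j - s j))"
      using large[of j] c_pos[of j] by simp
    moreover have "c j * (4 ^ j * (1 + s j) ^ j) = 2 ^ j"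
    proof -
      have "(4::real) ^ j = 2 ^ j * 2 ^ j" by (simp flip: power_mult_distrib)
      then show ?thesis using srv(1)[of j] by (simp add: c_def)
    qed
    ultimately show ?thesis by linarith
  qed
  moreover obtain j :: nat where "exp 1 * K < 2 ^ j"
    using real_arch_pow[of 2 "exp 1 * K"] by auto
  ultimately show False by (meson not_less)
qed
section \<open>Counting paths with separated jumps\<close>

definition mesh :: "nat \<Rightarrow> real" where
  "mesh m = 1 / (real m + 1)\<^sup>2"

text \<open>The left end point of the window of three cells whose middle cell is the \<open>i\<close>-th cell of
  \<open>[m + 1, m + 2]\<close>.  Starting from \<open>m + 1\<close> rather than \<open>m\<close> keeps the windows, which may begin one
  cell before that interval, inside the half-line.\<close>
definition window :: "nat \<Rightarrow> nat \<Rightarrow> real" where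
  "window m i = real m + 1 + (real i - 1) * mesh m"

definition sparse_jumps :: "(real \<Rightarrow> nat) \<Rightarrow> bool" where
  "sparse_jumps g \<longleftrightarrow> mono_on {0..} g \<and>
     (\<forall>\<^sub>F m in sequentially. \<forall>i<(m + 1)\<^sup>2. g (window m i + 3 * mesh m) \<le> g (window m i) + 1)"

lemma mesh_pos: "mesh m > 0" and mesh_le_1: "mesh m \<le> 1"
proof -
  show "mesh m > 0" by (simp add: mesh_def add_nonneg_pos)
  have "1 \<le> (real m + 1)\<^sup>2" by (intro one_le_power) auto
  then show "mesh m \<le> 1" by (simp add: mesh_def)
qed

lemma window_nonneg: "window m i \<ge> 0"
proof -
  have "(real i - 1) * mesh m \<ge> (-1) * mesh m"
    using mesh_pos[of m] by (intro mult_right_mono) auto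
  then show ?thesis using mesh_le_1[of m] by (simp add: window_def)
qed

lemma windows_cover:
  assumes "real m + 1 \<le> t" "t < real m + 2"
  obtains i where "i < (m + 1)\<^sup>2" "window m i + mesh m \<le> t" "t \<le> window m i + 2 * mesh m"
proof -
  define x where "x = (t - (real m + 1)) * (real m + 1)\<^sup>2"
  define i where "i = nat \<lfloor>x\<rfloor>"
  have x: "0 \<le> x" "x < (real m + 1)\<^sup>2" using assms
    by (simp_all add: x_def)
  then have i: "real i \<le> x" "x < real i + 1" by (auto simp: i_def) 
  have t: "t = real m + 1 + x * mesh m"
    by (simp add: x_def mesh_def add_nonneg_eq_0_iff)
  have "real i * mesh m \<le> x * mesh m" "x * mesh m \<le> (real i + 1) * mesh m"
    using i mesh_pos[of m] by (auto intro!: mult_right_mono)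
  then have "window m i + mesh m \<le> t" "t \<le> window m i + 2 * mesh m"
    unfolding t window_def by (simp_all add: algebra_simps)
  moreover have "real i < real ((m + 1)\<^sup>2)" using i x by (simp add: add.commute)
  then have "i < (m + 1)\<^sup>2" by (simp only: of_nat_less_iff)
  ultimately show ?thesis using that by blast
qed

text \<open>With at most one unit of increase over the window, \<open>g t\<close> agrees with the value of \<open>g\<close> at one
  of the two ends, and monotonicity makes \<open>g\<close> constant between \<open>t\<close> and that end, which is at
  least one cell away.\<close>
lemma sparse_jumps_constant_nearby:
  assumes mono: "mono_on {0..} g"
    and one: "g (window m i + 3 * mesh m) \<le> g (window m i) + (1::nat)"
    and t: "window m i + mesh m \<le> t" "t \<le> window m i + 2 * mesh m"
  obtains s where "0 \<le> s" "s \<le> t" "\<And>u. u \<in> {s..s + mesh m} \<Longrightarrow> g u = g t"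
proof -
  let ?a = "window m i" and ?b = "window m i + 3 * mesh m"
  note pos = mesh_pos[of m] window_nonneg[of m i]
  have le: "g u \<le> g w" if "?a \<le> u" "u \<le> w" for u w
    using mono_onD[OF mono, of u w] that pos by auto
  have "g ?a \<le> g t" "g t \<le> g ?b" using t pos by (auto intro!: le)
  with one consider "g t = g ?a" | "g t = g ?b" by linarith
  then show ?thesis
  proof cases
    case 1
    have const: "g u = g t" if u: "u \<in> {t - mesh m..t - mesh m + mesh m}" for u
    proof -
      have "?a \<le> u" "u \<le> t" using u t by auto
      then show ?thesis using le[of ?a u] le[of u t] 1 by linarith
    qed
    have "0 \<le> t - mesh m" "t - mesh m \<le> t" using t pos by linarith+
    then show ?thesis by (rule that[OF _ _ const])
  next
    case 2
    have const: "g u = g t" if u: "u \<in> {t..t + mesh m}" for u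
    proof -
      have "?a \<le> t" "t \<le> u" "u \<le> ?b" using u t pos by auto
      then show ?thesis using le[of t u] le[of u ?b] 2 by linarith
    qed
    have "0 \<le> t" "t \<le> t" using t pos by linarith+
    then show ?thesis by (rule that[OF _ _ const])
  qed
qed

text \<open>A constancy interval of width at least \<open>mesh m\<close>, which is of order \<open>1 / t\<^sup>2\<close>, turns the
  local bound of degree \<open>k\<close> into a pointwise bound of degree \<open>k + 2\<close>.\<close>
lemma slowly_growing_if_sparse_jumps:
  fixes S :: "nat \<Rightarrow> real"
  assumes sparse: "sparse_jumps g"
    and int: "\<And>\<phi>. \<phi> \<in> schwartz_space \<Longrightarrow> set_integrable lebesgue {0..} (\<lambda>t. S (g t) * \<phi> t)"
  shows "slowly_growing_on {0..} (\<lambda>t. S (g t))"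
proof -
  obtain k C where C: "C \<ge> 0"
    "\<And>s r v. 0 \<le> s \<Longrightarrow> s \<le> r \<Longrightarrow> r \<le> s + 1 \<Longrightarrow> 0 \<le> v \<Longrightarrow> (\<And>t. t \<in> {s..r} \<Longrightarrow> v \<le> \<bar>S (g t)\<bar>)
      \<Longrightarrow> v * (r - s) \<le> C * (1 + s) ^ k"
    by (rule integrable_against_schwartz_local_bound[where f = "\<lambda>t. S (g t)"]) (erule int, blast)
  have mono: "mono_on {0..} g" using sparse by (simp add: sparse_jumps_def)
  obtain m0 where m0:
    "\<And>m i. m \<ge> m0 \<Longrightarrow> i < (m + 1)\<^sup>2 \<Longrightarrow> g (window m i + 3 * mesh m) \<le> g (window m i) + 1"
    using sparse unfolding sparse_jumps_def eventually_sequentially by blast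
  define B where "B = (\<Sum>n\<le>g (real m0 + 1). \<bar>S n\<bar>)"
  have "B \<ge> 0" by (simp add: B_def sum_nonneg)
  have bound: "\<bar>S (g t)\<bar> \<le> (B + C) * (1 + t) ^ (k + 2)" if "t \<ge> 0" for t
  proof (cases "t < real m0 + 1")
    case True
    have "g t \<le> g (real m0 + 1)" using mono_onD[OF mono, of t "real m0 + 1"] that True by auto
    then have "\<bar>S (g t)\<bar> \<le> B"
      unfolding B_def by (intro member_le_sum) auto
    also have "B \<le> (B + C) * 1" using C by simp
    also have "\<dots> \<le> (B + C) * (1 + t) ^ (k + 2)"
      using that C \<open>B \<ge> 0\<close> by (intro mult_left_mono one_le_power) auto
    finally show ?thesis .
  next
    case False
    define m where "m = nat \<lfloor>t\<rfloor> - 1"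
    have "\<lfloor>t\<rfloor> \<ge> int m0 + 1" using False by linarith
    then have m_floor: "int m = \<lfloor>t\<rfloor> - 1" and m: "m \<ge> m0" unfolding m_def by linarith+
    then have "real m = of_int \<lfloor>t\<rfloor> - 1" by (metis of_int_1 of_int_diff of_int_of_nat_eq)
    then have t: "real m + 1 \<le> t" "t < real m + 2" by linarith+
    obtain i where i: "i < (m + 1)\<^sup>2" "window m i + mesh m \<le> t" "t \<le> window m i + 2 * mesh m"
      using windows_cover[OF t] .
    obtain s where s: "0 \<le> s" "s \<le> t" "\<And>u. u \<in> {s..s + mesh m} \<Longrightarrow> g u = g t"
      using sparse_jumps_constant_nearby[OF mono m0[OF m i(1)] i(2,3)] by blast
    have "\<bar>S (g t)\<bar> * (s + mesh m - s) \<le> C * (1 + s) ^ k"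
      using s mesh_pos[of m] mesh_le_1[of m] by (intro C) auto
    also have "\<dots> \<le> C * (1 + t) ^ k"
      using s C by (intro mult_left_mono power_mono) auto
    finally have "\<bar>S (g t)\<bar> \<le> C * (1 + t) ^ k * (real m + 1)\<^sup>2"
      by (simp add: mesh_def field_simps)
    also have "\<dots> \<le> C * (1 + t) ^ k * (1 + t)\<^sup>2"
      using t C that by (intro mult_left_mono power_mono) auto
    also have "\<dots> = C * (1 + t) ^ (k + 2)" by (simp add: power_add power2_eq_square)
    also have "\<dots> \<le> (B + C) * (1 + t) ^ (k + 2)"
      using \<open>B \<ge> 0\<close> that by (intro mult_right_mono) auto
    finally show ?thesis .
  qed
  have "\<bar>S (g t)\<bar> * (1 + \<bar>t\<bar>) powr (- real (k + 2)) \<le> B + C" if "t \<in> {0..}" for t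
  proof -
    have "t \<ge> 0" using that by simp
    have "(1 + \<bar>t\<bar>) powr (- real (k + 2)) = inverse ((1 + t) ^ (k + 2))"
      using \<open>t \<ge> 0\<close> powr_realpow[of "1 + t" "k + 2"] unfolding powr_minus by simp
    moreover have "\<bar>S (g t)\<bar> * inverse ((1 + t) ^ (k + 2)) \<le>
        (B + C) * (1 + t) ^ (k + 2) * inverse ((1 + t) ^ (k + 2))"
      using bound[OF \<open>t \<ge> 0\<close>] \<open>t \<ge> 0\<close> by (intro mult_right_mono) auto
    moreover have "(1 + t) ^ (k + 2) * inverse ((1 + t) ^ (k + 2)) = 1"
      using \<open>t \<ge> 0\<close> by (intro right_inverse) simp
    ultimately show ?thesis by (simp only: mult.assoc mult_1_right)
  qed
  then have "bdd_above ((\<lambda>t. \<bar>S (g t)\<bar> * (1 + \<bar>t\<bar>) powr (- real (k + 2))) ` {0..})"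
    by (intro bdd_aboveI2)
  then show ?thesis
    unfolding slowly_growing_on_def by (intro exI[of _ "real (k + 2)"]) auto
qed

section \<open>Jumps of Poisson processes\<close>

text \<open>The complementary probability is \<open>exp (- \<mu>) * (1 + \<mu>)\<close>, which is at least
  \<open>(1 - \<mu>) * (1 + \<mu>)\<close>.\<close>
lemma poisson_pmf_ge_2_le:
  assumes "\<mu> > 0"
  shows "measure_pmf.prob (poisson_pmf \<mu>) {2..} \<le> \<mu>\<^sup>2"
proof -
  have "measure_pmf.prob (poisson_pmf \<mu>) (UNIV - {0, 1}) =
      1 - measure_pmf.prob (poisson_pmf \<mu>) {0, 1}"
    using measure_pmf.prob_compl[of "{0, 1}" "poisson_pmf \<mu>"] by simp
  moreover have "UNIV - {0, 1} = {2::nat..}" by auto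
  moreover have "measure_pmf.prob (poisson_pmf \<mu>) {0, 1} = exp (- \<mu>) * (1 + \<mu>)"
    using assms by (subst measure_measure_pmf_finite) (auto simp: algebra_simps)
  moreover have "(1 - \<mu>) * (1 + \<mu>) \<le> exp (- \<mu>) * (1 + \<mu>)"
    using assms exp_ge_add_one_self[of "- \<mu>"] by (intro mult_right_mono) auto
  ultimately show ?thesis by (simp add: algebra_simps power2_eq_square)
qed

context prob_space
begin

lemma poisson_process_increment_prob:
  assumes "poisson_process rate N" and "0 \<le> s" "s < t"
  shows "{\<omega> \<in> space M. int (N t \<omega>) - int (N s \<omega>) \<in> I} \<in> events"
    and "prob {\<omega> \<in> space M. int (N t \<omega>) - int (N s \<omega>) \<in> I} =
         measure_pmf.prob (poisson_pmf (rate * (t - s))) (int -` I)"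
proof -
  let ?D = "\<lambda>\<omega>. int (N t \<omega>) - int (N s \<omega>)"
  have [measurable]: "N u \<in> measurable M (count_space UNIV)" if "u \<ge> 0" for u
    using assms(1) that by (simp add: poisson_process_def)
  have [measurable]: "N t \<in> measurable M (count_space UNIV)" "N s \<in> measurable M (count_space UNIV)"
    using assms(2,3) by auto
  have D: "?D \<in> measurable M (count_space UNIV)" by measurable
  show "{\<omega> \<in> space M. ?D \<omega> \<in> I} \<in> events"
    using measurable_sets[OF D, of I] by (simp add: vimage_def Int_def conj_commute)
  have "prob {\<omega> \<in> space M. ?D \<omega> \<in> I} = measure (distr M (count_space UNIV) ?D) I"
    using D by (simp add: measure_distr vimage_def Int_def conj_commute)
  also have "distr M (count_space UNIV) ?D = measure_pmf (map_pmf int (poisson_pmf (rate * (t - s))))"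
    using assms by (simp add: poisson_process_def)
  finally show "prob {\<omega> \<in> space M. ?D \<omega> \<in> I} =
         measure_pmf.prob (poisson_pmf (rate * (t - s))) (int -` I)"
    by simp
qed

text \<open>Increments over rational times are simultaneously nonnegative almost surely.  Real times
  reduce to rational ones because a right-continuous path with values in the discrete space of
  natural numbers is constant on some interval to the right of each time.\<close>
lemma poisson_process_AE_mono:
  assumes N: "poisson_process rate N"
  shows "AE \<omega> in M. mono_on {0..} (\<lambda>t. N t \<omega>)"
proof -
  have pair: "AE \<omega> in M. N s \<omega> \<le> N t \<omega>" if "0 \<le> s" "s < t" for s t
  proof -
    note E = poisson_process_increment_prob[OF N that, of "{0..}"]
    have "int -` {0..} = UNIV" by auto
    then have "prob {\<omega> \<in> space M. int (N t \<omega>) - int (N s \<omega>) \<in> {0..}} = 1"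
      using E(2) by simp
    from AE_prob_1[OF this] show ?thesis by (rule AE_mp) auto
  qed
  have "AE \<omega> in M. \<forall>p\<in>{(q, r). q \<in> \<rat> \<and> r \<in> \<rat> \<and> 0 \<le> q \<and> q < r}. N (fst p) \<omega> \<le> N (snd p) \<omega>"
  proof (rule AE_ball_countable[THEN iffD2])
    show "countable {(q, r :: real). q \<in> \<rat> \<and> r \<in> \<rat> \<and> 0 \<le> q \<and> q < r}"
      by (rule countable_subset[of _ "\<rat> \<times> \<rat>"]) (auto intro: countable_rat)
    show "\<forall>p\<in>{(q, r). q \<in> \<rat> \<and> r \<in> \<rat> \<and> 0 \<le> q \<and> q < r}. AE \<omega> in M. N (fst p) \<omega> \<le> N (snd p) \<omega>"
      using pair by auto
  qed
  moreover have "AE \<omega> in M. cadlag_on_halfline (\<lambda>t. N t \<omega>)"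
    using N by (simp add: poisson_process_def)
  ultimately show ?thesis
  proof eventually_elim
    case (elim \<omega>)
    have right: "\<exists>q\<in>\<rat>. t < q \<and> q < b \<and> N q \<omega> = N t \<omega>" if tb: "0 \<le> t" "t < b" for t b
    proof -
      have "((\<lambda>u. N u \<omega>) \<longlongrightarrow> N t \<omega>) (at_right t)"
        using elim(2) tb(1) by (simp add: cadlag_on_halfline_def continuous_within)
      then have "\<forall>\<^sub>F u in at_right t. N u \<omega> = N t \<omega>"
        by (simp add: tendsto_discrete)
      then obtain d where d: "d > t" "\<And>u. t < u \<Longrightarrow> u < d \<Longrightarrow> N u \<omega> = N t \<omega>"
        unfolding eventually_at_right_field by blast
      obtain q where "q \<in> \<rat>" "t < q" "q < min b d"
        using Rats_dense_in_real[of t "min b d"] d(1) tb(2) by auto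
      with d show ?thesis by auto
    qed
    show ?case
    proof (rule mono_onI)
      fix s t :: real assume st: "s \<in> {0..}" "t \<in> {0..}" "s \<le> t"
      show "N s \<omega> \<le> N t \<omega>"
      proof (cases "s = t")
        case False
        obtain q where q: "q \<in> \<rat>" "s < q" "q < t" "N q \<omega> = N s \<omega>"
          using right[of s t] st False by auto
        obtain r where r: "r \<in> \<rat>" "t < r" "N r \<omega> = N t \<omega>"
          using right[of t "t + 1"] st by auto
        have "N (fst (q, r)) \<omega> \<le> N (snd (q, r)) \<omega>"
          using q r st by (intro elim(1)[rule_format]) auto
        with q r show ?thesis by simp
      qed simp
    qed
  qed
qed

text \<open>Monotonicity is almost sure by the previous lemma.  For the windows at level \<open>m\<close> the union
  bound gives \<open>(m + 1)\<^sup>2 * (3 * rate * mesh m)\<^sup>2 = 9 * rate\<^sup>2 / (m + 1)\<^sup>2\<close>, which is summable, so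
  the first Borel--Cantelli lemma applies.\<close>
lemma poisson_process_AE_sparse_jumps:
  assumes N: "poisson_process rate N" and rate: "rate > 0"
  shows "AE \<omega> in M. sparse_jumps (\<lambda>t. N t \<omega>)"
proof -
  define E where "E m i = {\<omega> \<in> space M.
      int (N (window m i + 3 * mesh m) \<omega>) - int (N (window m i) \<omega>) \<in> {2..}}" for m i
  define B where "B m = (\<Union>i<(m + 1)\<^sup>2. E m i)" for m
  have E: "E m i \<in> events" "prob (E m i) \<le> (rate * (3 * mesh m))\<^sup>2" for m i
  proof -
    have "window m i < window m i + 3 * mesh m" using mesh_pos by simp
    note * = poisson_process_increment_prob[OF N window_nonneg this, of "{2..}"]
    show "E m i \<in> events" unfolding E_def by (rule *(1))
    have "int -` {2..} = {2..}" by auto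
    then show "prob (E m i) \<le> (rate * (3 * mesh m))\<^sup>2"
      unfolding E_def *(2) using poisson_pmf_ge_2_le[of "rate * (3 * mesh m)"] rate mesh_pos[of m]
      by simp
  qed
  have B: "B m \<in> events" for m using E by (auto simp: B_def)
  have prob_B: "prob (B m) \<le> 9 * rate\<^sup>2 * (1 / (real m + 1)\<^sup>2)" for m
  proof -
    have "prob (B m) \<le> (\<Sum>i<(m + 1)\<^sup>2. prob (E m i))"
      unfolding B_def using E by (intro finite_measure_subadditive_finite) auto
    also have "\<dots> \<le> (\<Sum>i<(m + 1)\<^sup>2. (rate * (3 * mesh m))\<^sup>2)" by (intro sum_mono E)
    also have "\<dots> = (real m + 1)\<^sup>2 * (9 * rate\<^sup>2 * (mesh m)\<^sup>2)"
      by (simp add: power_mult_distrib add.commute)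
    also have "\<dots> = 9 * rate\<^sup>2 * ((real m + 1)\<^sup>2 * mesh m * mesh m)"
      by (simp add: power2_eq_square)
    also have "(real m + 1)\<^sup>2 * mesh m = 1" by (simp add: mesh_def add_nonneg_eq_0_iff)
    finally show ?thesis by (simp add: mesh_def)
  qed
  have "summable (\<lambda>m. prob (B m))"
  proof (rule summable_comparison_test')
    have "summable (\<lambda>m. 1 / (real (Suc m))\<^sup>2)"
      using inverse_power_summable[of 2, where ?'a = real]
      by (subst summable_Suc_iff) (simp add: field_simps)
    then show "summable (\<lambda>m. 9 * rate\<^sup>2 * (1 / (real m + 1)\<^sup>2))"
      by (intro summable_mult) (simp add: add.commute)
  qed (use prob_B in auto)
  then have "AE \<omega> in M. \<forall>\<^sub>F m in sequentially. \<omega> \<in> space M - B m"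
    using B by (intro borel_cantelli_AE1) (auto simp: emeasure_eq_measure)
  with poisson_process_AE_mono[OF N] show ?thesis
  proof eventually_elim
    case (elim \<omega>)
    from elim(2) have "\<forall>\<^sub>F m in sequentially. \<forall>i<(m + 1)\<^sup>2.
        N (window m i + 3 * mesh m) \<omega> \<le> N (window m i) \<omega> + 1"
      by eventually_elim (force simp: B_def E_def)
    with elim(1) show ?case by (simp add: sparse_jumps_def)
  qed
qed

end

section \<open>Slow growth of tempered compound Poisson paths\<close>

theorem proposition2p3:
  fixes M :: "'a measure" and rate :: real
    and N :: "real \<Rightarrow> 'a \<Rightarrow> nat" and Y :: "nat \<Rightarrow> 'a \<Rightarrow> real"
    and X :: "real \<Rightarrow> 'a \<Rightarrow> real"
  assumes "prob_space M" and "complete_measure M"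
    and "rate > 0"
    and "prob_space.poisson_process M rate N"
    and "prob_space.iid_sequence M Y"
    and "prob_space.indep_process_sequence M N Y"
    and "X = compound_process N Y"
  shows "\<exists>A \<in> sets M. measure M A = 1 \<and>
           (\<forall>\<omega> \<in> tempered_event M X \<inter> A. slowly_growing_on {0..} (\<lambda>t. X t \<omega>))"
proof -
  interpret prob_space M by fact
  have "AE \<omega> in M. sparse_jumps (\<lambda>t. N t \<omega>)"
    using assms(3,4) by (intro poisson_process_AE_sparse_jumps)
  then obtain Z where Z: "{\<omega> \<in> space M. \<not> sparse_jumps (\<lambda>t. N t \<omega>)} \<subseteq> Z" "emeasure M Z = 0" "Z \<in> events"
    by (rule AE_E)
  have "prob (space M - Z) = 1"
    using Z by (simp add: prob_compl emeasure_eq_measure)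
  moreover have "slowly_growing_on {0..} (\<lambda>t. X t \<omega>)" if "\<omega> \<in> tempered_event M X \<inter> (space M - Z)" for \<omega>
  proof -
    have "sparse_jumps (\<lambda>t. N t \<omega>)" using that Z by blast
    moreover have X: "X t \<omega> = (\<Sum>i=1..N t \<omega>. Y i \<omega>)" for t
      by (simp add: assms(7) compound_process_def)
    ultimately show ?thesis
      using slowly_growing_if_sparse_jumps[of "\<lambda>t. N t \<omega>" "\<lambda>n. \<Sum>i=1..n. Y i \<omega>"] that
      by (simp add: tempered_event_def halfline_fun_tempered_def)
  qed
  ultimately show ?thesis using Z(3) by (intro bexI[of _ "space M - Z"]) auto
qed

end
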